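(* Any countable J\'onsson-Tarski algebra can be extended into $2^{\aleph_1}$ many pairwise nonisomorphic J\'onsson J\'onsson-Tarski algebras of cardinality $\aleph_1$. That is, for every countable J\'onsson-Tarski algebra $A$ there is a family of $2^{\aleph_1}$ many pairwise nonisomorphic J\'onsson-Tarski algebras of cardinality $\aleph_1$, each of which contains (an isomorphic copy of) $A$ as a subalgebra and each of which is a J\'onsson algebra.
   Context: A J\'onsson-Tarski algebra is an algebra $A$ with one binary operation $\cdot$ and two unary operations $\ell$ and $r$ satisfying the identities $\ell(x\cdot y)=x$, $r(x\cdot y)=y$, and $\ell(z)\cdot r(z)=z$. A J\'onsson algebra is an infinite algebra $J$, in a countable algebraic language (finitary operations), which has no proper subalgebras of the same cardinality as $J$. A J\'onsson J\'onsson-Tarski algebra is a J\'onsson-Tarski algebra that is also a J\'onsson algebra. Isomorphism means isomorphism of algebras in the language $\{\cdot,\ell,r\}$. *)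

theory Defs
  imports Main "HOL-Library.Countable_Set"
begin

unbundle cardinal_syntax

(* Universal algebra over a language given by a type 'f of operation symbols together with an
   arity function. Operations take argument lists; only the values at lists over the universe
   of the correct length are meaningful. The empty universe is not excluded. *)

record ('f, 'a) ualg =
  universe :: "'a set"
  interp :: "'f \<Rightarrow> 'a list \<Rightarrow> 'a"

definition args :: "('f \<Rightarrow> nat) \<Rightarrow> ('f, 'a) ualg \<Rightarrow> 'f \<Rightarrow> 'a list set" where
  "args ar A f = {xs. set xs \<subseteq> universe A \<and> length xs = ar f}"

definition is_ualg :: "('f \<Rightarrow> nat) \<Rightarrow> ('f, 'a) ualg \<Rightarrow> bool" where
  "is_ualg ar A \<longleftrightarrow> (\<forall>f. \<forall>xs\<in>args ar A f. interp A f xs \<in> universe A)"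

definition subalgebra :: "('f \<Rightarrow> nat) \<Rightarrow> ('f, 'a) ualg \<Rightarrow> ('f, 'a) ualg \<Rightarrow> bool" where
  "subalgebra ar B A \<longleftrightarrow> is_ualg ar B \<and> universe B \<subseteq> universe A \<and>
     (\<forall>f. \<forall>xs\<in>args ar B f. interp B f xs = interp A f xs)"

definition isomorphic :: "('f \<Rightarrow> nat) \<Rightarrow> ('f, 'a) ualg \<Rightarrow> ('f, 'b) ualg \<Rightarrow> bool" where
  "isomorphic ar A B \<longleftrightarrow> (\<exists>h. bij_betw h (universe A) (universe B) \<and>
     (\<forall>f. \<forall>xs\<in>args ar A f. h (interp A f xs) = interp B f (map h xs)))"

definition jonsson_algebra :: "('f \<Rightarrow> nat) \<Rightarrow> ('f, 'a) ualg \<Rightarrow> bool" where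
  "jonsson_algebra ar A \<longleftrightarrow> is_ualg ar A \<and> countable (UNIV :: 'f set) \<and> infinite (universe A) \<and>
     \<not> (\<exists>B. subalgebra ar B A \<and> universe B \<noteq> universe A \<and> |universe B| =o |universe A| )"

datatype jt_sym = Mult | Left | Right

fun jt_arity :: "jt_sym \<Rightarrow> nat" where
  "jt_arity Mult = 2"
| "jt_arity Left = 1"
| "jt_arity Right = 1"

definition jt_algebra :: "(jt_sym, 'a) ualg \<Rightarrow> bool" where
  "jt_algebra A \<longleftrightarrow> is_ualg jt_arity A \<and>
     (\<forall>x\<in>universe A. \<forall>y\<in>universe A. interp A Left [interp A Mult [x, y]] = x) \<and>
     (\<forall>x\<in>universe A. \<forall>y\<in>universe A. interp A Right [interp A Mult [x, y]] = y) \<and>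
     (\<forall>z\<in>universe A. interp A Mult [interp A Left [z], interp A Right [z]] = z)"

definition jonsson_jt_algebra :: "(jt_sym, 'a) ualg \<Rightarrow> bool" where
  "jonsson_jt_algebra A \<longleftrightarrow> jt_algebra A \<and> jonsson_algebra jt_arity A"

(* The cardinal successor of the order type of nat. It is realised on the type nat set, so
   every algebra of this cardinality is isomorphic to one with universe in nat set. *)

abbreviation aleph_one :: "nat set rel" where
  "aleph_one \<equiv> cardSuc natLeq"

end

theory Submission
  imports Defs "HOL-Library.Countable_Set_Type" "HOL-Library.Nat_Bijection"
begin

text \<open>
  A Jonsson-Tarski algebra is a set \<open>X\<close> with a bijection \<open>X \<times> X \<rightarrow> X\<close>, so one can be built by prescribing
  \<open>\<ell>\<close> and \<open>r\<close> on some generators and then adjoining freely every product that is still missing.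
  Adjoin to \<open>A\<close> generators \<open>Core \<alpha> j\<close>, for \<open>\<alpha> < \<omega>\<^sub>1\<close> and \<open>j < \<omega>\<close>, with \<open>\<ell> (Core \<alpha> j) = Core \<alpha> (j + 1)\<close>.
  For each \<open>\<alpha>\<close> let the values \<open>r (Core \<alpha> j)\<close>, as \<open>j\<close> grows, run infinitely often through all of \<open>A\<close> and all
  \<open>Core \<beta> 0\<close> with \<open>\<beta> \<le> \<alpha>\<close>. Every value of \<open>r\<close> on a generator is again an element of \<open>A\<close> or a generator, so
  the elements of the completion are simply the binary terms over \<open>A\<close> and the generators in which no
  product can be contracted, and no transfinite recursion is needed.

  Let \<open>level \<alpha>\<close> be the countable subalgebra of all elements that only mention indices \<open>\<le> \<alpha>\<close>.
  An element that mentions \<open>\<alpha>\<close> yields, by repeated \<open>\<ell>\<close> and \<open>r\<close>, some \<open>Core \<alpha> j\<close>, hence all \<open>Core \<alpha> i\<close> with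
  \<open>i \<ge> j\<close>, hence \<open>A\<close> and every \<open>Core \<beta> 0\<close> with \<open>\<beta> \<le> \<alpha>\<close>, hence all of \<open>level \<alpha>\<close> (\<open>level_subset_of_index\<close>).
  A subalgebra that is not contained in \<open>A\<close> is therefore an initial segment of the levels. An
  uncountable one contains every level, which is the Jonsson property (\<open>tower_jonsson\<close>).

  To obtain many isomorphism types, let \<open>r (Core \<alpha> j) = Core \<alpha> j\<close> for exactly \<open>t \<alpha>\<close> values of \<open>j\<close>, where
  \<open>t \<alpha>\<close> is a positive number. Then \<open>t \<alpha>\<close> is the number of fixed points of \<open>r\<close> that first appear in
  \<open>level \<alpha>\<close>. Since the levels are determined by the algebra once \<open>A\<close> is, an isomorphism that maps \<open>A\<close>
  onto \<open>A\<close> preserves each level and therefore \<open>t\<close>. An isomorphism could a priori map \<open>A\<close> to a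
  later stage of the chain; this is excluded by reserving some values of \<open>t\<close> for the least index
  (\<open>tower_rigid\<close>). Two values remain free at every index, and this gives
  \<open>2\<close> to the power \<open>\<aleph>\<^sub>1\<close> algebras.
\<close>

section \<open>Subuniverses and isomorphisms\<close>

definition subuniverse :: "('f \<Rightarrow> nat) \<Rightarrow> ('f, 'a) ualg \<Rightarrow> 'a set \<Rightarrow> bool" where
  "subuniverse ar A S \<longleftrightarrow> S \<subseteq> universe A \<and>
     (\<forall>f xs. set xs \<subseteq> S \<longrightarrow> length xs = ar f \<longrightarrow> interp A f xs \<in> S)"

definition algebra_iso :: "('f \<Rightarrow> nat) \<Rightarrow> ('f, 'a) ualg \<Rightarrow> ('f, 'b) ualg \<Rightarrow> ('a \<Rightarrow> 'b) \<Rightarrow> bool" where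
  "algebra_iso ar A B h \<longleftrightarrow> bij_betw h (universe A) (universe B) \<and>
     (\<forall>f. \<forall>xs\<in>args ar A f. h (interp A f xs) = interp B f (map h xs))"

lemma isomorphic_iff_algebra_iso: "isomorphic ar A B \<longleftrightarrow> (\<exists>h. algebra_iso ar A B h)"
  unfolding isomorphic_def algebra_iso_def ..

lemma algebra_iso_refl: "algebra_iso ar A A id"
  by (simp add: algebra_iso_def)

lemma algebra_iso_inv:
  assumes A: "is_ualg ar A" and h: "algebra_iso ar A B h"
  shows "algebra_iso ar B A (inv_into (universe A) h)"
proof -
  let ?k = "inv_into (universe A) h"
  have bij: "bij_betw h (universe A) (universe B)"
    and hom: "\<And>f xs. xs \<in> args ar A f \<Longrightarrow> h (interp A f xs) = interp B f (map h xs)"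
    using h unfolding algebra_iso_def by auto
  have "?k (interp B f ys) = interp A f (map ?k ys)" if ys: "ys \<in> args ar B f" for f ys
  proof -
    have k_in: "?k y \<in> universe A" "h (?k y) = y" if "y \<in> set ys" for y
      using that ys bij by (auto simp: args_def bij_betw_def inv_into_into f_inv_into_f subset_iff)
    have xs: "map ?k ys \<in> args ar A f"
      using k_in ys by (auto simp: args_def)
    have "map h (map ?k ys) = ys"
      using k_in by (simp add: map_idI)
    then have "h (interp A f (map ?k ys)) = interp B f ys"
      using hom[OF xs] by simp
    moreover have "interp A f (map ?k ys) \<in> universe A"
      using A xs by (auto simp: is_ualg_def)
    ultimately show ?thesis
      using bij by (metis bij_betw_def inv_into_f_f)
  qed
  then show ?thesis
    unfolding algebra_iso_def using bij by (auto intro: bij_betw_inv_into)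
qed

lemma algebra_iso_trans:
  assumes "algebra_iso ar A B h" and "algebra_iso ar B C k"
  shows "algebra_iso ar A C (k \<circ> h)"
proof -
  have "map h xs \<in> args ar B f" if "xs \<in> args ar A f" for f xs
    using that assms(1) by (auto simp: algebra_iso_def args_def bij_betw_def)
  then show ?thesis
    using assms by (auto simp: algebra_iso_def intro: bij_betw_trans)
qed

lemma subuniverse_image:
  assumes h: "algebra_iso ar A B h" and S: "subuniverse ar A S"
  shows "subuniverse ar B (h ` S)"
  unfolding subuniverse_def
proof (intro conjI allI impI)
  show "h ` S \<subseteq> universe B"
    using h S unfolding algebra_iso_def subuniverse_def bij_betw_def by blast
next
  fix f ys assume ys: "set ys \<subseteq> h ` S" "length ys = ar f"
  define xs where "xs = map (inv_into S h) ys"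
  have "h (inv_into S h y) = y" "inv_into S h y \<in> S" if "y \<in> set ys" for y
    using ys(1) that by (auto intro: f_inv_into_f inv_into_into)
  then have xs: "set xs \<subseteq> S" "ys = map h xs"
    unfolding xs_def by (auto simp: map_idI)
  with ys(2) S have "interp A f xs \<in> S" and "xs \<in> args ar A f"
    by (auto simp: subuniverse_def args_def)
  with h xs(2) show "interp B f ys \<in> h ` S"
    unfolding algebra_iso_def by (metis imageI)
qed

lemma subuniverse_of_subalgebra:
  assumes "subalgebra ar B A"
  shows "subuniverse ar A (universe B)"
  using assms by (auto simp: subuniverse_def subalgebra_def is_ualg_def args_def)

lemma subalgebra_of_subuniverse:
  assumes "subuniverse ar A S"
  shows "subalgebra ar \<lparr>universe = S, interp = interp A\<rparr> A"
  using assms by (auto simp: subuniverse_def subalgebra_def is_ualg_def args_def)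

text \<open>Only the universe of a subalgebra matters here, and universes, unlike algebras with their
  arbitrary values outside the universe, are mapped well by isomorphisms.\<close>

lemma jonsson_algebra_iff:
  fixes A :: "('f, 'a) ualg"
  shows "jonsson_algebra ar A \<longleftrightarrow> is_ualg ar A \<and> countable (UNIV :: 'f set) \<and> infinite (universe A) \<and>
     (\<forall>S. subuniverse ar A S \<longrightarrow> |S| =o |universe A| \<longrightarrow> S = universe A)"
proof -
  have "(\<exists>B. subalgebra ar B A \<and> universe B \<noteq> universe A \<and> |universe B| =o |universe A| ) \<longleftrightarrow>
        (\<exists>S. subuniverse ar A S \<and> S \<noteq> universe A \<and> |S| =o |universe A| )"
    by (metis subuniverse_of_subalgebra subalgebra_of_subuniverse ualg.select_convs(1))
  then show ?thesis
    unfolding jonsson_algebra_def by auto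
qed

lemma algebra_iso_is_ualg:
  assumes "algebra_iso ar A B h" and "is_ualg ar A"
  shows "is_ualg ar B"
proof -
  have "subuniverse ar A (universe A)"
    using assms(2) by (auto simp: subuniverse_def is_ualg_def args_def)
  from subuniverse_image[OF assms(1) this] have "subuniverse ar B (universe B)"
    using assms(1) by (simp add: algebra_iso_def bij_betw_def)
  then show ?thesis
    by (auto simp: subuniverse_def is_ualg_def args_def)
qed

lemma algebra_iso_jonsson:
  assumes h: "algebra_iso ar A B h" and J: "jonsson_algebra ar A"
  shows "jonsson_algebra ar B"
proof -
  let ?k = "inv_into (universe A) h"
  have A: "is_ualg ar A" using J by (simp add: jonsson_algebra_def)
  have bij: "bij_betw h (universe A) (universe B)" using h by (simp add: algebra_iso_def)
  have k: "algebra_iso ar B A ?k" by (rule algebra_iso_inv[OF A h])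
  have "S = universe B" if S: "subuniverse ar B S" "|S| =o |universe B|" for S
  proof -
    have SB: "S \<subseteq> universe B" using S by (simp add: subuniverse_def)
    have bk: "inj_on ?k (universe B)" "?k ` universe B = universe A"
      using k by (simp_all add: algebra_iso_def bij_betw_def)
    have "inj_on ?k S" using bk(1) SB by (rule inj_on_subset)
    then have "|?k ` S| =o |S|"
      by (rule ordIso_symmetric[OF card_of_ordIsoI[OF inj_on_imp_bij_betw]])
    moreover have "|universe B| =o |universe A|"
      using bk by (intro card_of_ordIsoI[of ?k]) (simp add: bij_betw_def)
    ultimately have "|?k ` S| =o |universe A|"
      using S(2) by (meson ordIso_transitive)
    with subuniverse_image[OF k S(1)] J have "?k ` S = ?k ` universe B"
      unfolding jonsson_algebra_iff bk(2) by blast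
    then show ?thesis
      using inj_on_image_eq_iff[OF bk(1) SB order_refl] by blast
  qed
  moreover have "infinite (universe B)"
    using J bij bij_betw_finite by (auto simp: jonsson_algebra_def)
  ultimately show ?thesis
    using J algebra_iso_is_ualg[OF h A] by (simp add: jonsson_algebra_iff)
qed

lemma algebra_iso_jt:
  assumes h: "algebra_iso jt_arity A B h" and A: "jt_algebra A"
  shows "jt_algebra B"
proof -
  have alg: "is_ualg jt_arity A" using A by (simp add: jt_algebra_def)
  have bij: "universe B = h ` universe A" using h by (simp add: algebra_iso_def bij_betw_def)
  have hom: "h (interp A f xs) = interp B f (map h xs)"
    if "set xs \<subseteq> universe A" "length xs = jt_arity f" for f xs
    using h that by (simp add: algebra_iso_def args_def)
  have in_A: "interp A f xs \<in> universe A" if "set xs \<subseteq> universe A" "length xs = jt_arity f" for f xs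
    using alg that by (auto simp: is_ualg_def args_def)
  have M: "interp B Mult [h x, h y] = h (interp A Mult [x, y])" "interp A Mult [x, y] \<in> universe A"
    if "x \<in> universe A" "y \<in> universe A" for x y
    using hom[of "[x, y]" Mult] in_A[of "[x, y]" Mult] that by simp_all
  have L: "interp B Left [h x] = h (interp A Left [x])" "interp A Left [x] \<in> universe A"
    and R: "interp B Right [h x] = h (interp A Right [x])" "interp A Right [x] \<in> universe A"
    if "x \<in> universe A" for x
    using hom[of "[x]" Left] in_A[of "[x]" Left] hom[of "[x]" Right] in_A[of "[x]" Right] that
    by simp_all
  show ?thesis
    using A algebra_iso_is_ualg[OF h alg]
    by (auto simp: jt_algebra_def bij M L R)
qed

text \<open>The copy of an algebra along a map that is injective on its universe; it moves the algebras of
  terms constructed below to the type \<^typ>\<open>nat set\<close>.\<close>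

definition transport :: "('a \<Rightarrow> 'b) \<Rightarrow> ('f, 'a) ualg \<Rightarrow> ('f, 'b) ualg" where
  "transport g A = \<lparr>universe = g ` universe A,
     interp = \<lambda>f xs. g (interp A f (map (inv_into (universe A) g) xs))\<rparr>"

lemma algebra_iso_transport:
  assumes "inj_on g (universe A)"
  shows "algebra_iso ar A (transport g A) g"
proof -
  have "map (inv_into (universe A) g \<circ> g) xs = xs" if "set xs \<subseteq> universe A" for xs
    using assms that by (intro map_idI) (auto simp: subset_iff)
  then show ?thesis
    using assms by (auto simp: algebra_iso_def transport_def args_def inj_on_imp_bij_betw)
qed

lemma embedding_image:
  assumes A: "is_ualg ar A" and inj: "inj_on k (universe A)" and into: "k ` universe A \<subseteq> universe B"
    and hom: "\<And>f xs. xs \<in> args ar A f \<Longrightarrow> k (interp A f xs) = interp B f (map k xs)"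
  shows "\<exists>C. subalgebra ar C B \<and> isomorphic ar A C"
proof -
  let ?C = "\<lparr>universe = k ` universe A, interp = interp B\<rparr>"
  have iso: "algebra_iso ar A ?C k"
    using inj hom by (auto simp: algebra_iso_def inj_on_imp_bij_betw)
  then have "is_ualg ar ?C"
    using A algebra_iso_is_ualg by blast
  then have "subalgebra ar ?C B"
    using into by (simp add: subalgebra_def)
  with iso show ?thesis
    by (auto simp: isomorphic_iff_algebra_iso)
qed

section \<open>The first uncountable ordinal as a type\<close>

text \<open>As a type of class \<^class>\<open>wellorder\<close>, the ordinal has least elements, induction and intervals at hand.
  The construction rests on two of its properties: its cardinality is \<open>\<aleph>\<^sub>1\<close>, and its proper initial
  segments are countable.\<close>

typedef omega_one = "Field aleph_one"
proof -
  have "Field aleph_one \<noteq> {}"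
    using Field_cardSuc_not_empty[OF natLeq_Card_order] .
  then show ?thesis by blast
qed

lemma aleph_one_Card_order: "Card_order aleph_one"
  by (simp add: cardSuc_Card_order natLeq_Card_order)

lemma aleph_one_Well_order: "Well_order aleph_one"
  using aleph_one_Card_order by (simp add: card_order_on_def)

instantiation omega_one :: wellorder
begin

definition less_eq_omega_one :: "omega_one \<Rightarrow> omega_one \<Rightarrow> bool" where
  "x \<le> y \<longleftrightarrow> (Rep_omega_one x, Rep_omega_one y) \<in> aleph_one"

definition less_omega_one :: "omega_one \<Rightarrow> omega_one \<Rightarrow> bool" where
  "x < (y :: omega_one) \<longleftrightarrow> x \<le> y \<and> x \<noteq> y"

instance
proof
  have lin: "Linear_order aleph_one" and wf: "wf (aleph_one - Id)"
    using aleph_one_Well_order by (auto simp: well_order_on_def)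
  then have refl: "Refl aleph_one" and trans: "trans aleph_one" and anti: "antisym aleph_one"
    and tot: "Total aleph_one"
    by (auto simp: linear_order_on_def partial_order_on_def preorder_on_def)
  fix x y z :: omega_one
  show "x \<le> x"
    using refl Rep_omega_one by (auto simp: less_eq_omega_one_def refl_on_def)
  show "x \<le> y \<Longrightarrow> y \<le> z \<Longrightarrow> x \<le> z"
    using trans by (auto simp: less_eq_omega_one_def dest: transD)
  show "x \<le> y \<Longrightarrow> y \<le> x \<Longrightarrow> x = y" for x y :: omega_one
    using anti by (auto simp: less_eq_omega_one_def Rep_omega_one_inject dest: antisymD)
  then show "x < y \<longleftrightarrow> x \<le> y \<and> \<not> y \<le> x"
    using \<open>x \<le> x\<close> by (auto simp: less_omega_one_def)
  show "x \<le> y \<or> y \<le> x"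
    using tot Rep_omega_one[of x] Rep_omega_one[of y] \<open>x \<le> x\<close>
    by (cases "x = y") (auto simp: less_eq_omega_one_def total_on_def Rep_omega_one_inject)
  fix P :: "omega_one \<Rightarrow> bool" and a
  assume step: "\<And>x. (\<And>y. y < x \<Longrightarrow> P y) \<Longrightarrow> P x"
  have "wf (inv_image (aleph_one - Id) Rep_omega_one)"
    using wf by simp
  then show "P a"
  proof (induction a rule: wf_induct_rule)
    case (less x)
    show ?case
      by (rule step, rule less)
        (simp add: less_omega_one_def less_eq_omega_one_def Rep_omega_one_inject)
  qed
qed

end

lemma card_omega_one: "|UNIV :: omega_one set| =o aleph_one"
proof -
  have "bij_betw Rep_omega_one UNIV (Field aleph_one)"
    using type_definition.Rep_range[OF type_definition_omega_one]
    by (auto simp: bij_betw_def inj_on_def Rep_omega_one_inject)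
  then have "|UNIV :: omega_one set| =o |Field aleph_one|"
    using card_of_ordIso by blast
  then show ?thesis
    using aleph_one_Card_order card_of_Field_ordIso ordIso_transitive by blast
qed

lemma uncountable_omega_one: "uncountable (UNIV :: omega_one set)"
proof
  assume "countable (UNIV :: omega_one set)"
  then have "|UNIV :: omega_one set| \<le>o natLeq"
    by (simp add: countable_card_le_natLeq)
  then have "aleph_one \<le>o natLeq"
    using card_omega_one ordIso_ordLeq_trans ordIso_symmetric by blast
  then show False
    using cardSuc_greater[OF natLeq_Card_order] not_ordLess_ordLeq by blast
qed

lemma countable_lessThan_omega_one: "countable {..<a :: omega_one}"
proof -
  have "Rep_omega_one ` {..<a} \<subseteq> underS aleph_one (Rep_omega_one a)"
    by (auto simp: underS_def less_omega_one_def less_eq_omega_one_def Rep_omega_one_inject)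
  moreover have "|underS aleph_one (Rep_omega_one a)| <o aleph_one"
    by (rule card_of_underS[OF aleph_one_Card_order Rep_omega_one])
  then have "|underS aleph_one (Rep_omega_one a)| \<le>o natLeq"
    by (rule iffD1[OF cardSuc_ordLeq_ordLess[OF natLeq_Card_order card_of_Card_order]])
  then have "countable (underS aleph_one (Rep_omega_one a))"
    by (simp add: countable_card_le_natLeq)
  ultimately have "countable (Rep_omega_one ` {..<a})"
    by (rule countable_subset)
  then show ?thesis
    by (rule countable_image_inj_on) (auto simp: inj_on_def Rep_omega_one_inject)
qed

lemma countable_atMost_omega_one: "countable {..a :: omega_one}"
proof -
  have "{..a} = insert a {..<a}" by auto
  then show ?thesis using countable_lessThan_omega_one[of a] by simp
qed

section \<open>The construction\<close>

text \<open>This turns closure under operations on argument lists into closure under one binary and two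
  unary functions.\<close>

lemma all_jt_args_iff:
  "(\<forall>f xs. P xs \<longrightarrow> length xs = jt_arity f \<longrightarrow> Q f xs) \<longleftrightarrow>
     (\<forall>x y. P [x, y] \<longrightarrow> Q Mult [x, y]) \<and> (\<forall>x. P [x] \<longrightarrow> Q Left [x]) \<and> (\<forall>x. P [x] \<longrightarrow> Q Right [x])"
  (is "?L \<longleftrightarrow> ?R")
proof
  assume L: ?L
  show ?R
  proof (intro conjI allI impI)
    show "Q Mult [x, y]" if "P [x, y]" for x y using L[rule_format, of "[x, y]" Mult] that by simp
    show "Q Left [x]" if "P [x]" for x using L[rule_format, of "[x]" Left] that by simp
    show "Q Right [x]" if "P [x]" for x using L[rule_format, of "[x]" Right] that by simp
  qed
next
  assume R: ?R
  show ?L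
  proof (intro allI impI)
    fix f xs assume "P xs" "length xs = jt_arity f"
    with R show "Q f xs"
      by (cases f) (auto simp: length_Suc_conv numeral_2_eq_2)
  qed
qed

text \<open>Terms over the elements of the given algebra and over generators indexed by \<^typ>\<open>'i\<close> and the
  natural numbers.\<close>

datatype (bases: 'a, indices: 'i) elt = Base 'a | Core 'i nat | Pair "('a, 'i) elt" "('a, 'i) elt"

instance elt :: (countable, countable) countable
  by countable_datatype

lemma finite_indices: "finite (indices x)"
  by (induction x) auto


locale countable_jt =
  fixes A :: "(jt_sym, 'a) ualg"
  assumes jt: "jt_algebra A" and countable_A: "countable (universe A)"
begin

text \<open>The values that \<open>r\<close> must take on \<open>Core \<alpha> 0, Core \<alpha> 1, \<dots>\<close>. As \<open>Core \<alpha> 0\<close> is among them, the generators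
  \<open>Core \<alpha> j\<close> with \<open>j < k\<close>, which \<open>\<ell>\<close> does not reach from \<open>Core \<alpha> k\<close>, are recovered; moreover the set is
  nonempty also for an empty algebra.\<close>

definition targets :: "omega_one \<Rightarrow> ('a, omega_one) elt set" where
  "targets \<alpha> = Base ` universe A \<union> (\<lambda>\<beta>. Core \<beta> 0) ` {..\<alpha>}"

text \<open>The first component of a decoded pair runs through every natural number infinitely often, which
  is why every target recurs beyond any bound. The first \<open>t \<alpha>\<close> places are reserved for the fixed
  points of \<open>r\<close> that mark the index \<open>\<alpha>\<close>.\<close>

definition right_core :: "(omega_one \<Rightarrow> nat) \<Rightarrow> omega_one \<Rightarrow> nat \<Rightarrow> ('a, omega_one) elt" where
  "right_core t \<alpha> j =
     (if j < t \<alpha> then Core \<alpha> j else from_nat_into (targets \<alpha>) (fst (prod_decode j)))"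

fun left :: "('a, omega_one) elt \<Rightarrow> ('a, omega_one) elt" where
  "left (Base a) = Base (interp A Left [a])"
| "left (Core \<alpha> j) = Core \<alpha> (Suc j)"
| "left (Pair x y) = x"

fun right :: "(omega_one \<Rightarrow> nat) \<Rightarrow> ('a, omega_one) elt \<Rightarrow> ('a, omega_one) elt" where
  "right t (Base a) = Base (interp A Right [a])"
| "right t (Core \<alpha> j) = right_core t \<alpha> j"
| "right t (Pair x y) = y"

text \<open>A formal pair is contracted exactly when it is \<open>(\<ell> z, r z)\<close> for an element of the algebra or a
  generator \<open>z\<close>.\<close>

fun mult :: "(omega_one \<Rightarrow> nat) \<Rightarrow> ('a, omega_one) elt \<Rightarrow> ('a, omega_one) elt \<Rightarrow> ('a, omega_one) elt" where
  "mult t (Base a) (Base b) = Base (interp A Mult [a, b])"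
| "mult t (Core \<alpha> (Suc j)) y = (if y = right_core t \<alpha> j then Core \<alpha> j else Pair (Core \<alpha> (Suc j)) y)"
| "mult t x y = Pair x y"

fun normal :: "(omega_one \<Rightarrow> nat) \<Rightarrow> ('a, omega_one) elt \<Rightarrow> bool" where
  "normal t (Base a) \<longleftrightarrow> a \<in> universe A"
| "normal t (Core \<alpha> j) \<longleftrightarrow> True"
| "normal t (Pair x y) \<longleftrightarrow> normal t x \<and> normal t y \<and> mult t x y = Pair x y"

definition tower :: "(omega_one \<Rightarrow> nat) \<Rightarrow> (jt_sym, ('a, omega_one) elt) ualg" where
  "tower t = \<lparr>universe = {x. normal t x},
     interp = \<lambda>f xs. case f of Mult \<Rightarrow> mult t (xs ! 0) (xs ! 1)
                | Left \<Rightarrow> left (xs ! 0) | Right \<Rightarrow> right t (xs ! 0)\<rparr>"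

lemma base_closed:
  "a \<in> universe A \<Longrightarrow> interp A Left [a] \<in> universe A"
  "a \<in> universe A \<Longrightarrow> interp A Right [a] \<in> universe A"
  "a \<in> universe A \<Longrightarrow> b \<in> universe A \<Longrightarrow> interp A Mult [a, b] \<in> universe A"
proof -
  have "interp A f xs \<in> universe A" if "set xs \<subseteq> universe A" "length xs = jt_arity f" for f xs
    using jt that by (auto simp: jt_algebra_def is_ualg_def args_def)
  from this[of "[a]" Left] this[of "[a]" Right] this[of "[a, b]" Mult]
  show "a \<in> universe A \<Longrightarrow> interp A Left [a] \<in> universe A"
    "a \<in> universe A \<Longrightarrow> interp A Right [a] \<in> universe A"
    "a \<in> universe A \<Longrightarrow> b \<in> universe A \<Longrightarrow> interp A Mult [a, b] \<in> universe A"
    by simp_all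
qed

lemma countable_targets: "countable (targets \<alpha>)"
  using countable_A countable_atMost_omega_one by (simp add: targets_def)

lemma targets_nonempty: "targets \<alpha> \<noteq> {}"
  by (auto simp: targets_def)

lemma right_core_cases: "right_core t \<alpha> j \<in> targets \<alpha> \<or> right_core t \<alpha> j = Core \<alpha> j"
  by (simp add: right_core_def from_nat_into[OF targets_nonempty])

lemma right_core_normal: "normal t (right_core t \<alpha> j)"
  using right_core_cases[of t \<alpha> j] by (auto simp: targets_def)

lemma right_core_indices: "indices (right_core t \<alpha> j) \<subseteq> {..\<alpha>}"
  using right_core_cases[of t \<alpha> j] by (auto simp: targets_def)

lemma right_core_recurs:
  assumes "x \<in> targets \<alpha>"
  shows "\<exists>j\<ge>k. right_core t \<alpha> j = x"
proof -
  obtain i where i: "from_nat_into (targets \<alpha>) i = x"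
    using assms from_nat_into_surj[OF countable_targets] by blast
  define j where "j = prod_encode (i, k + t \<alpha>)"
  have "k + t \<alpha> \<le> j" unfolding j_def by (rule le_prod_encode_2)
  moreover from this have "right_core t \<alpha> j = x"
    using i by (simp add: right_core_def j_def)
  ultimately show ?thesis by (auto intro: exI[of _ j])
qed

text \<open>The hypothesis makes position \<open>0\<close> a reserved one. Without it, the enumeration of the targets, which
  include \<open>Core \<alpha> 0\<close>, might produce one more fixed point there.\<close>

lemma right_core_fixpoint:
  assumes "t \<alpha> \<noteq> 0"
  shows "right_core t \<alpha> j = Core \<alpha> j \<longleftrightarrow> j < t \<alpha>"
proof -
  have "Core \<alpha> j \<notin> targets \<alpha>" if "\<not> j < t \<alpha>"
    using that assms by (auto simp: targets_def)
  then show ?thesis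
    by (metis from_nat_into[OF targets_nonempty] right_core_def)
qed

lemma mult_left_right: "normal t x \<Longrightarrow> mult t (left x) (right t x) = x"
  using jt by (cases x) (auto simp: jt_algebra_def)

lemma left_mult: "normal t x \<Longrightarrow> normal t y \<Longrightarrow> left (mult t x y) = x"
  using jt by (induction t x y rule: mult.induct) (auto simp: jt_algebra_def)

lemma right_mult: "normal t x \<Longrightarrow> normal t y \<Longrightarrow> right t (mult t x y) = y"
  using jt by (induction t x y rule: mult.induct) (auto simp: jt_algebra_def)

lemma normal_left: "normal t x \<Longrightarrow> normal t (left x)"
  by (cases x) (auto simp: base_closed)

lemma normal_right: "normal t x \<Longrightarrow> normal t (right t x)"
  by (cases x) (auto simp: base_closed right_core_normal)

lemma normal_mult: "normal t x \<Longrightarrow> normal t y \<Longrightarrow> normal t (mult t x y)"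
  by (induction t x y rule: mult.induct) (auto simp: base_closed)

lemma indices_left: "indices (left x) \<subseteq> indices x"
  by (cases x) auto

lemma indices_right: "indices x \<subseteq> {..\<alpha>} \<Longrightarrow> indices (right t x) \<subseteq> {..\<alpha>}"
proof (cases x)
  case (Core \<beta> j)
  assume "indices x \<subseteq> {..\<alpha>}"
  with Core show ?thesis using right_core_indices[of t \<beta> j] by auto
qed auto

lemma indices_mult: "indices (mult t x y) \<subseteq> indices x \<union> indices y"
  by (induction t x y rule: mult.induct) auto

lemma subuniverse_tower_iff:
  "subuniverse jt_arity (tower t) S \<longleftrightarrow> S \<subseteq> {x. normal t x} \<and>
     (\<forall>x\<in>S. \<forall>y\<in>S. mult t x y \<in> S) \<and> (\<forall>x\<in>S. left x \<in> S) \<and> (\<forall>x\<in>S. right t x \<in> S)"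
  unfolding subuniverse_def all_jt_args_iff by (auto simp: tower_def)

lemma tower_is_ualg: "is_ualg jt_arity (tower t)"
proof -
  have "subuniverse jt_arity (tower t) (universe (tower t))"
    unfolding subuniverse_tower_iff
    by (auto simp: tower_def normal_left normal_right normal_mult)
  then show ?thesis
    by (auto simp: subuniverse_def is_ualg_def args_def)
qed

lemma tower_jt: "jt_algebra (tower t)"
  unfolding jt_algebra_def using tower_is_ualg
  by (auto simp: tower_def left_mult right_mult mult_left_right)

section \<open>Levels and the subalgebras they determine\<close>

definition below :: "(omega_one \<Rightarrow> nat) \<Rightarrow> omega_one \<Rightarrow> ('a, omega_one) elt set" where
  "below t \<alpha> = {x. normal t x \<and> indices x \<subseteq> {..<\<alpha>}}"

definition level :: "(omega_one \<Rightarrow> nat) \<Rightarrow> omega_one \<Rightarrow> ('a, omega_one) elt set" where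
  "level t \<alpha> = {x. normal t x \<and> indices x \<subseteq> {..\<alpha>}}"

lemma subuniverse_level: "subuniverse jt_arity (tower t) (level t \<alpha>)"
  unfolding subuniverse_tower_iff level_def
  using indices_left indices_right indices_mult
  by (auto simp: normal_left normal_right normal_mult) blast+

lemma level_mono: "\<alpha> \<le> \<beta> \<Longrightarrow> level t \<alpha> \<subseteq> level t \<beta>"
  by (auto simp: level_def)

lemma below_subset_level: "below t \<alpha> \<subseteq> level t \<alpha>"
  by (auto simp: level_def below_def)

lemma normal_no_index: "normal t x \<Longrightarrow> indices x = {} \<Longrightarrow> x \<in> Base ` universe A"
  by (induction x) auto

text \<open>The heart of the construction: an element that mentions an index generates the whole level of
  that index.\<close>

lemma level_subset_of_index:
  assumes S: "subuniverse jt_arity (tower t) S" and x: "x \<in> S" "\<alpha> \<in> indices x"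
  shows "level t \<alpha> \<subseteq> S"
proof -
  have L: "\<And>x. x \<in> S \<Longrightarrow> left x \<in> S" and R: "\<And>x. x \<in> S \<Longrightarrow> right t x \<in> S"
    and M: "\<And>x y. x \<in> S \<Longrightarrow> y \<in> S \<Longrightarrow> mult t x y \<in> S"
    using S by (auto simp: subuniverse_tower_iff)
  \<comment> \<open>Applying \<open>\<ell>\<close> moves up along the generators of one index.\<close>
  have up: "Core \<beta> (j + i) \<in> S" if "Core \<beta> j \<in> S" for \<beta> j i
    using that by (induction i) (use L in fastforce)+
  have targets: "targets \<beta> \<subseteq> S" if "Core \<beta> j \<in> S" for \<beta> j
  proof
    fix y assume "y \<in> targets \<beta>"
    then obtain i where "j \<le> i" and i: "right_core t \<beta> i = y"
      using right_core_recurs by blast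
    then have "Core \<beta> i \<in> S"
      using up[OF that, of "i - j"] by simp
    with R i show "y \<in> S" by force
  qed
  \<comment> \<open>Taking a formal pair apart with \<open>\<ell>\<close> and \<open>r\<close> yields all its subterms.\<close>
  have "\<exists>j. Core \<alpha> j \<in> S"
    using x by (induction x) (use L R in \<open>force+\<close>)
  then have T: "targets \<alpha> \<subseteq> S"
    using targets by blast
  have "y \<in> S" if "normal t y" "indices y \<subseteq> {..\<alpha>}" for y
    using that
  proof (induction y)
    case (Base a)
    then show ?case using T by (auto simp: targets_def)
  next
    case (Core \<beta> j)
    then have "Core \<beta> 0 \<in> S" using T by (auto simp: targets_def)
    then show ?case using up[of \<beta> 0 j] by simp
  next
    case (Pair u v)
    then show ?case using M[of u v] by auto
  qed
  then show ?thesis by (auto simp: level_def)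
qed

text \<open>Levels increase with their index, so an element outside \<open>below t \<alpha>\<close>, which mentions some index
  \<open>\<ge> \<alpha>\<close>, already generates \<open>level t \<alpha>\<close>.\<close>

lemma level_subset:
  assumes S: "subuniverse jt_arity (tower t) S" and x: "x \<in> S" "x \<notin> below t \<alpha>"
  shows "level t \<alpha> \<subseteq> S"
proof -
  have "normal t x" using S x by (auto simp: subuniverse_tower_iff)
  with x obtain \<beta> where "\<beta> \<in> indices x" "\<not> \<beta> < \<alpha>"
    by (auto simp: below_def)
  then have "\<beta> \<in> indices x" "\<alpha> \<le> \<beta>" by simp_all
  then show ?thesis
    using level_subset_of_index[OF S x(1)] level_mono by blast
qed

lemma normal_in_level: "normal t x \<Longrightarrow> \<exists>\<alpha>. x \<in> level t \<alpha>"
proof (cases "indices x = {}")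
  case False
  assume "normal t x"
  then have "x \<in> level t (Max (indices x))"
    using finite_indices[of x] by (auto simp: level_def)
  then show ?thesis ..
qed (auto simp: level_def)

text \<open>Enumerating the elements and the indices that may occur turns such terms injectively into terms
  over the natural numbers.\<close>

lemma countable_level: "countable (level t \<alpha>)"
proof -
  let ?f = "map_elt (to_nat_on (universe A)) (to_nat_on {..\<alpha>})"
  have "inj_on ?f {x. bases x \<subseteq> universe A \<and> indices x \<subseteq> {..\<alpha>}}"
  proof (rule inj_onI)
    fix x y :: "('a, omega_one) elt"
    assume "x \<in> {x. bases x \<subseteq> universe A \<and> indices x \<subseteq> {..\<alpha>}}"
      "y \<in> {x. bases x \<subseteq> universe A \<and> indices x \<subseteq> {..\<alpha>}}" "?f x = ?f y"
    then show "x = y"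
      using inj_on_to_nat_on[OF countable_A] inj_on_to_nat_on[OF countable_atMost_omega_one[of \<alpha>]]
      by (intro elt.inj_map_strong[of x y _ _ _ _]) (auto simp: inj_on_def subset_iff)
  qed
  moreover have "bases x \<subseteq> universe A" if "normal t x" for x
    using that by (induction x) auto
  then have "level t \<alpha> \<subseteq> {x. bases x \<subseteq> universe A \<and> indices x \<subseteq> {..\<alpha>}}"
    by (auto simp: level_def)
  ultimately have "inj_on ?f (level t \<alpha>)"
    by (rule inj_on_subset)
  then show ?thesis
    by (rule countable_image_inj_on[rotated]) simp
qed

lemma below_eq: "below t \<alpha> = Base ` universe A \<union> (\<Union>\<beta><\<alpha>. level t \<beta>)"
proof (intro equalityI subsetI)
  fix x assume x: "x \<in> below t \<alpha>"
  show "x \<in> Base ` universe A \<union> (\<Union>\<beta><\<alpha>. level t \<beta>)"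
  proof (cases "indices x = {}")
    case True
    then show ?thesis using x normal_no_index by (auto simp: below_def)
  next
    case False
    then have "Max (indices x) \<in> indices x"
      using finite_indices by simp
    moreover have "x \<in> level t (Max (indices x))"
      using x finite_indices[of x] by (auto simp: level_def below_def)
    ultimately show ?thesis using x by (auto simp: below_def)
  qed
qed (auto simp: below_def level_def)

lemma Core_notin_below: "Core \<alpha> j \<notin> below t \<alpha>"
  by (simp add: below_def)

lemma Core_in_level: "Core \<alpha> j \<in> level t \<alpha>"
  by (simp add: level_def)

text \<open>Being countable, such a subalgebra cannot contain all levels. If \<open>\<alpha>\<close> is the least index whose level it does not
  contain, then by \<open>level_subset\<close> all its elements lie below \<open>\<alpha>\<close>.\<close>

lemma subuniverse_eq_below:
  assumes S: "subuniverse jt_arity (tower t) S" "countable S" "Base ` universe A \<subseteq> S"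
  shows "\<exists>\<alpha>. S = below t \<alpha>"
proof -
  have "\<exists>\<alpha>. \<not> level t \<alpha> \<subseteq> S"
  proof (rule ccontr)
    assume "\<not> ?thesis"
    then have "range (\<lambda>\<alpha>. Core \<alpha> 0) \<subseteq> S" using Core_in_level by blast
    then have "countable (range (\<lambda>\<alpha> :: omega_one. Core \<alpha> 0 :: ('a, omega_one) elt))"
      using S(2) countable_subset by blast
    then show False
      using uncountable_omega_one countable_image_inj_on[of "\<lambda>\<alpha>. Core \<alpha> 0" UNIV]
      by (auto simp: inj_on_def)
  qed
  define \<alpha> where "\<alpha> = (LEAST \<alpha>. \<not> level t \<alpha> \<subseteq> S)"
  have not: "\<not> level t \<alpha> \<subseteq> S"
    unfolding \<alpha>_def using \<open>\<exists>\<alpha>. \<not> level t \<alpha> \<subseteq> S\<close> by (rule LeastI_ex)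
  have "level t \<beta> \<subseteq> S" if "\<beta> < \<alpha>" for \<beta>
    using not_less_Least[OF that[unfolded \<alpha>_def]] by simp
  then have "below t \<alpha> \<subseteq> S"
    using S(3) unfolding below_eq by blast
  moreover have "S \<subseteq> below t \<alpha>"
    using level_subset[OF S(1)] not by blast
  ultimately show ?thesis by blast
qed

section \<open>Cardinality and the Jonsson property\<close>

lemma card_tower: "|universe (tower t)| =o aleph_one"
proof -
  have U: "universe (tower t) = (\<Union>\<alpha>. level t \<alpha>)"
    using normal_in_level by (auto simp: tower_def level_def)
  have inf: "infinite (UNIV :: omega_one set)"
    using uncountable_omega_one uncountable_infinite by blast
  have "|level t \<alpha>| \<le>o |UNIV :: omega_one set|" for \<alpha>
  proof -
    have "|level t \<alpha>| \<le>o |UNIV :: nat set|"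
      using countable_level by (simp flip: countable_card_of_nat)
    moreover have "|UNIV :: nat set| \<le>o |UNIV :: omega_one set|"
      using inf by (simp flip: infinite_iff_card_of_nat)
    ultimately show ?thesis by (rule ordLeq_transitive)
  qed
  then have "|universe (tower t)| \<le>o |UNIV :: omega_one set|"
    unfolding U by (intro card_of_UNION_ordLeq_infinite[OF inf] card_of_mono1 ballI) auto
  moreover have "|UNIV :: omega_one set| \<le>o |universe (tower t)|"
    by (rule card_of_ordLeqI[of "\<lambda>\<alpha>. Core \<alpha> 0"]) (auto simp: inj_on_def tower_def)
  ultimately have "|universe (tower t)| =o |UNIV :: omega_one set|"
    by (simp add: ordIso_iff_ordLeq)
  then show ?thesis
    using card_omega_one by (rule ordIso_transitive)
qed

text \<open>Each \<open>below t \<alpha>\<close> is countable, so an uncountable subalgebra has elements outside it and thus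
  contains \<open>level t \<alpha>\<close>; the levels exhaust the algebra.\<close>

lemma tower_jonsson: "jonsson_algebra jt_arity (tower t)"
  unfolding jonsson_algebra_iff
proof (intro conjI allI impI)
  have "(UNIV :: jt_sym set) = {Mult, Left, Right}"
    using jt_sym.exhaust by blast
  then show "countable (UNIV :: jt_sym set)"
    by (metis countable_finite finite.intros)
next
  show inf: "infinite (universe (tower t))"
  proof
    assume "finite (universe (tower t))"
    then have "finite (range (\<lambda>j. Core undefined j :: ('a, omega_one) elt))"
      by (rule rev_finite_subset) (auto simp: tower_def)
    then show False
      by (simp add: finite_image_iff inj_on_def)
  qed
next
  fix S assume S: "subuniverse jt_arity (tower t) S" "|S| =o |universe (tower t)|"
  have "\<not> countable S"
  proof
    assume "countable S"
    then have "|S| \<le>o natLeq" by (simp add: countable_card_le_natLeq)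
    moreover have "|S| =o aleph_one" using S(2) card_tower by (rule ordIso_transitive)
    ultimately have "aleph_one \<le>o natLeq"
      by (meson ordIso_ordLeq_trans ordIso_symmetric)
    then show False
      using cardSuc_greater[OF natLeq_Card_order] not_ordLess_ordLeq by blast
  qed
  then have "\<not> S \<subseteq> below t \<alpha>" for \<alpha>
    using countable_level countable_subset below_subset_level by metis
  then have "level t \<alpha> \<subseteq> S" for \<alpha>
    using level_subset[OF S(1)] by blast
  then show "S = universe (tower t)"
    using S(1) normal_in_level by (fastforce simp: tower_def subuniverse_def)
qed (rule tower_is_ualg)

section \<open>Recovering the marking from the isomorphism type\<close>

definition fixpoints :: "(omega_one \<Rightarrow> nat) \<Rightarrow> omega_one \<Rightarrow> ('a, omega_one) elt set" where
  "fixpoints t \<alpha> = {x \<in> level t \<alpha> - below t \<alpha>. right t x = x}"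

text \<open>A formal pair is larger than its second component, so only generators can be fixed points
  of \<open>r\<close> outside the given algebra.\<close>

lemma card_fixpoints:
  assumes "t \<alpha> \<noteq> 0"
  shows "card (fixpoints t \<alpha>) = t \<alpha>"
proof -
  have "x \<in> Core \<alpha> ` {..<t \<alpha>}" if "x \<in> fixpoints t \<alpha>" for x
  proof (cases x)
    case (Base a)
    then show ?thesis using that by (auto simp: fixpoints_def below_def level_def)
  next
    case (Core \<beta> j)
    then have "\<beta> = \<alpha>" using that by (auto simp: fixpoints_def below_def level_def)
    then show ?thesis
      using that Core right_core_fixpoint[of t \<alpha>, OF assms] by (auto simp: fixpoints_def)
  next
    case (Pair u v)
    then have "v = Pair u v" using that by (simp add: fixpoints_def)
    then have "size v = size (Pair u v)" by (rule arg_cong)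
    then show ?thesis by simp
  qed
  moreover have "Core \<alpha> j \<in> fixpoints t \<alpha>" if "j < t \<alpha>" for j
    using that right_core_fixpoint[of t \<alpha>, OF assms]
    by (simp add: fixpoints_def Core_in_level Core_notin_below)
  ultimately have "fixpoints t \<alpha> = Core \<alpha> ` {..<t \<alpha>}" by blast
  then show ?thesis by (simp add: card_image inj_on_def)
qed

lemma iso_tower_right:
  assumes "algebra_iso jt_arity (tower t) (tower t') h" and "normal t x"
  shows "h (right t x) = right t' (h x)"
proof -
  have "[x] \<in> args jt_arity (tower t) Right"
    using assms(2) by (simp add: args_def tower_def)
  then have "h (interp (tower t) Right [x]) = interp (tower t') Right (map h [x])"
    using assms(1) unfolding algebra_iso_def by blast
  then show ?thesis by (simp add: tower_def)
qed

lemma iso_tower_inj: "algebra_iso jt_arity (tower t) (tower t') h \<Longrightarrow> inj_on h {x. normal t x}"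
  by (simp add: algebra_iso_def bij_betw_def tower_def)

text \<open>The image of the generator \<open>Core \<alpha> 0\<close> lies outside \<open>below t' \<beta>\<close>, so it generates at
  least \<open>level t' \<beta>\<close>.\<close>

lemma iso_level_superset:
  assumes h: "algebra_iso jt_arity (tower t) (tower t') h"
    and below: "h ` below t \<alpha> = below t' \<beta>"
  shows "level t' \<beta> \<subseteq> h ` level t \<alpha>"
proof (rule level_subset[OF subuniverse_image[OF h subuniverse_level]])
  show "h (Core \<alpha> 0) \<in> h ` level t \<alpha>"
    using Core_in_level by blast
  show "h (Core \<alpha> 0) \<notin> below t' \<beta>"
  proof
    assume "h (Core \<alpha> 0) \<in> below t' \<beta>"
    then obtain x where "x \<in> below t \<alpha>" "h (Core \<alpha> 0) = h x"
      unfolding below[symmetric] by blast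
    then have "Core \<alpha> 0 \<in> below t \<alpha>"
      using inj_onD[OF iso_tower_inj[OF h]] by (force simp: below_def)
    then show False by (simp add: Core_notin_below)
  qed
qed

text \<open>Equality of the levels follows from \<open>iso_level_superset\<close> for the isomorphism and for its inverse.
  The fixed points of \<open>r\<close> in the two differences then correspond to each other. The two indices may
  differ, because \<open>tower_rigid\<close> has to refute an isomorphism that shifts the levels.\<close>

lemma iso_step:
  assumes h: "algebra_iso jt_arity (tower t) (tower t') h"
    and below: "h ` below t \<alpha> = below t' \<beta>"
  shows iso_level: "h ` level t \<alpha> = level t' \<beta>"
    and iso_mark: "t \<alpha> \<noteq> 0 \<Longrightarrow> t' \<beta> \<noteq> 0 \<Longrightarrow> t \<alpha> = t' \<beta>"
proof -
  let ?U = "{x. normal t x}" and ?k = "inv_into (universe (tower t)) h"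
  have inj: "inj_on h ?U" by (rule iso_tower_inj[OF h])
  have U: "universe (tower t) = ?U" by (simp add: tower_def)
  have sub: "level t \<alpha> \<subseteq> ?U" "below t \<alpha> \<subseteq> ?U"
    by (auto simp: level_def below_def)
  have k: "algebra_iso jt_arity (tower t') (tower t) ?k"
    by (rule algebra_iso_inv[OF tower_is_ualg h])
  have "?k ` below t' \<beta> = below t \<alpha>"
    unfolding below[symmetric] U by (rule inv_into_image_cancel[OF inj sub(2)])
  then have "level t \<alpha> \<subseteq> ?k ` level t' \<beta>"
    by (rule iso_level_superset[OF k])
  then have "h ` level t \<alpha> \<subseteq> h ` ?k ` level t' \<beta>" by (rule image_mono)
  also have "h ` ?k ` level t' \<beta> = level t' \<beta>"
    using h by (intro image_inv_into_cancel)
      (auto simp: algebra_iso_def bij_betw_def tower_def level_def)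
  finally show level: "h ` level t \<alpha> = level t' \<beta>"
    using iso_level_superset[OF h below] by blast
  assume nz: "t \<alpha> \<noteq> 0" "t' \<beta> \<noteq> 0"
  have new: "h ` (level t \<alpha> - below t \<alpha>) = level t' \<beta> - below t' \<beta>"
    using inj_on_image_set_diff[OF inj, of "level t \<alpha>" "below t \<alpha>"] sub level below by auto
  have "right t' (h x) = h x \<longleftrightarrow> right t x = x" if "x \<in> ?U" for x
    using iso_tower_right[OF h, of x] inj_onD[OF inj, of "right t x" x] normal_right[of t x] that
    by auto
  then have "h ` fixpoints t \<alpha> = {y \<in> h ` (level t \<alpha> - below t \<alpha>). right t' y = y}"
    using sub by (auto simp: fixpoints_def)
  then have "h ` fixpoints t \<alpha> = fixpoints t' \<beta>"
    unfolding new by (simp add: fixpoints_def)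
  moreover have "card (h ` fixpoints t \<alpha>) = card (fixpoints t \<alpha>)"
    using sub by (intro card_image inj_on_subset[OF inj]) (auto simp: fixpoints_def)
  ultimately show "t \<alpha> = t' \<beta>"
    using nz by (simp add: card_fixpoints)
qed

text \<open>An isomorphism maps the given algebra, which is the part below the least index, into the copy of it in
  the other tower: otherwise its image would be the part below some later index \<open>\<alpha>\<close>, and by \<open>iso_mark\<close> the mark of the
  least index would reappear at \<open>\<alpha>\<close>. The same holds for the inverse. From this starting point
  \<open>iso_level\<close> shows by induction that all levels, and hence all marks, are preserved.\<close>

lemma tower_rigid:
  assumes h: "algebra_iso jt_arity (tower t) (tower t') h"
    and nz: "\<And>\<alpha>. t \<alpha> \<noteq> 0" "\<And>\<alpha>. t' \<alpha> \<noteq> 0"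
    and z_least: "\<And>\<alpha>. z \<le> (\<alpha> :: omega_one)"
    and marks: "\<And>\<alpha>. \<alpha> \<noteq> z \<Longrightarrow> t z \<noteq> t' \<alpha>" "\<And>\<alpha>. \<alpha> \<noteq> z \<Longrightarrow> t' z \<noteq> t \<alpha>"
  shows "t = t'"
proof -
  have below_z: "below s z = Base ` universe A" for s
    using z_least by (auto simp: below_eq not_less[symmetric])
  have sub: "g ` below s z \<subseteq> below s' z"
    if g: "algebra_iso jt_arity (tower s) (tower s') g"
      and nz: "\<And>\<alpha>. s \<alpha> \<noteq> 0" "\<And>\<alpha>. s' \<alpha> \<noteq> 0"
      and mark: "\<And>\<alpha>. \<alpha> \<noteq> z \<Longrightarrow> s z \<noteq> s' \<alpha>" for g s s'
  proof (rule ccontr)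
    have below: "subuniverse jt_arity (tower s) (below s z)"
      unfolding below_z subuniverse_tower_iff by (auto simp: base_closed)
    let ?S = "g ` below s z"
    have S: "subuniverse jt_arity (tower s') ?S"
      by (rule subuniverse_image[OF g below])
    assume not: "\<not> ?S \<subseteq> below s' z"
    then have "level s' z \<subseteq> ?S"
      using level_subset[OF S] by blast
    then have "Base ` universe A \<subseteq> ?S"
      using below_subset_level below_z by blast
    moreover have "countable ?S"
      unfolding below_z using countable_A by simp
    ultimately obtain \<alpha> where \<alpha>: "?S = below s' \<alpha>"
      using subuniverse_eq_below[OF S] by blast
    with not have "\<alpha> \<noteq> z" by auto
    then show False
      using iso_mark[OF g \<alpha>] nz mark by blast
  qed
  let ?k = "inv_into (universe (tower t)) h"
  have k: "algebra_iso jt_arity (tower t') (tower t) ?k"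
    by (rule algebra_iso_inv[OF tower_is_ualg h])
  have "h ` ?k ` below t' z = below t' z"
    using h by (intro image_inv_into_cancel)
      (auto simp: algebra_iso_def bij_betw_def tower_def below_def)
  moreover have "?k ` below t' z \<subseteq> below t z"
    by (rule sub[OF k nz(2) nz(1) marks(2)])
  ultimately have "below t' z \<subseteq> h ` below t z"
    by (metis image_mono)
  then have base: "h ` below t z = below t' z"
    using sub[OF h nz marks(1)] by blast
  have below: "h ` below t \<alpha> = below t' \<alpha>" for \<alpha>
  proof (induction \<alpha> rule: less_induct)
    case (less \<alpha>)
    then have "h ` level t \<beta> = level t' \<beta>" if "\<beta> < \<alpha>" for \<beta>
      using that iso_level[OF h] by blast
    then have "h ` (\<Union>\<beta><\<alpha>. level t \<beta>) = (\<Union>\<beta><\<alpha>. level t' \<beta>)"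
      unfolding image_UN by simp
    with base show ?case
      unfolding below_z by (subst (1 2) below_eq) (simp add: image_Un)
  qed
  show ?thesis
    using iso_mark[OF h below] nz by blast
qed

end

section \<open>The family of extensions\<close>

text \<open>The marks at the least index are \<open>3\<close> and \<open>4\<close>, all others are \<open>1\<close> and \<open>2\<close>.\<close>

definition marking :: "omega_one set \<Rightarrow> omega_one \<Rightarrow> nat" where
  "marking S \<alpha> = (if \<forall>\<beta>. \<alpha> \<le> \<beta> then 3 else 1) + (if \<alpha> \<in> S then 1 else 0)"

lemma card_Pow_omega_one: "|UNIV :: omega_one set set| =o ctwo ^c aleph_one"
proof -
  have "|Pow (UNIV :: omega_one set)| =o ctwo ^c |UNIV :: omega_one set|"
    unfolding ctwo_def cexp_def Field_card_of by (rule card_of_Pow_Func)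
  moreover have "ctwo ^c |UNIV :: omega_one set| =o ctwo ^c aleph_one"
    by (rule cexp_cong2[OF card_omega_one Card_order_ctwo card_of_Card_order])
  ultimately show ?thesis
    using ordIso_transitive by (simp add: Pow_UNIV) blast
qed

theorem theorem4p1:
  fixes A :: "(jt_sym, 'a) ualg"
  assumes "jt_algebra A" and "countable (universe A)"
  shows "\<exists>F :: (jt_sym, nat set) ualg set.
           |F| =o ctwo ^c aleph_one \<and>
           (\<forall>B\<in>F. jonsson_jt_algebra B \<and> |universe B| =o aleph_one \<and>
              (\<exists>C. subalgebra jt_arity C B \<and> isomorphic jt_arity A C)) \<and>
           (\<forall>B\<in>F. \<forall>C\<in>F. B \<noteq> C \<longrightarrow> \<not> isomorphic jt_arity B C)"
proof -
  interpret countable_jt A using assms by unfold_locales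
  define J where "J S = tower (marking S)" for S
  define z :: omega_one where "z = (LEAST \<alpha>. True)"
  have z: "z \<le> \<alpha>" for \<alpha> unfolding z_def by (rule Least_le) simp
  have mark: "marking S z \<ge> 3" "\<alpha> \<noteq> z \<Longrightarrow> marking S \<alpha> < 3" "marking S \<alpha> \<noteq> 0" for S \<alpha>
    using z[of \<alpha>] z by (auto simp: marking_def dest: antisym)
  have marking_inj: "S = T" if "marking S = marking T" for S T
  proof -
    have "\<alpha> \<in> S \<longleftrightarrow> \<alpha> \<in> T" for \<alpha>
      using fun_cong[OF that, of \<alpha>] by (auto simp: marking_def split: if_splits)
    then show ?thesis by blast
  qed
  have "\<exists>g :: _ \<Rightarrow> nat set. inj_on g (universe (J S))" for S
  proof -
    have "|universe (J S)| =o |Field aleph_one|"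
      using card_tower ordIso_symmetric[OF card_of_Field_ordIso[OF aleph_one_Card_order]]
      unfolding J_def by (rule ordIso_transitive)
    then have "|universe (J S)| \<le>o |UNIV :: nat set set|"
      using card_of_mono1[OF subset_UNIV] by (rule ordIso_ordLeq_trans)
    then show ?thesis
      by (simp flip: card_of_ordLeq)
  qed
  then obtain g :: "omega_one set \<Rightarrow> ('a, omega_one) elt \<Rightarrow> nat set"
    where g: "inj_on (g S) (universe (J S))" for S
    by metis
  define B :: "omega_one set \<Rightarrow> (jt_sym, nat set) ualg" where "B S = transport (g S) (J S)" for S
  have iso: "algebra_iso jt_arity (J S) (B S) (g S)" for S
    unfolding B_def by (rule algebra_iso_transport[OF g])
  have B_inj: "S = T" if BT: "isomorphic jt_arity (B S) (B T)" for S T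
  proof -
    obtain h where "algebra_iso jt_arity (B S) (B T) h"
      using BT by (auto simp: isomorphic_iff_algebra_iso)
    then have h: "algebra_iso jt_arity (J S) (J T)
        (inv_into (universe (J T)) (g T) \<circ> (h \<circ> g S))"
      using iso tower_is_ualg unfolding J_def by (metis algebra_iso_trans algebra_iso_inv)
    have "marking S = marking T"
    proof (rule tower_rigid[OF h[unfolded J_def] mark(3) mark(3) z])
      show "marking S z \<noteq> marking T \<alpha>" "marking T z \<noteq> marking S \<alpha>" if "\<alpha> \<noteq> z" for \<alpha>
        using mark(1)[of S] mark(1)[of T] mark(2)[OF that, of S] mark(2)[OF that, of T] by auto
    qed
    then show ?thesis by (rule marking_inj)
  qed
  have B_props: "jonsson_jt_algebra (B S) \<and> |universe (B S)| =o aleph_one \<and>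
      (\<exists>C. subalgebra jt_arity C (B S) \<and> isomorphic jt_arity A C)" for S
  proof (intro conjI)
    show "jonsson_jt_algebra (B S)"
      using algebra_iso_jt[OF iso] algebra_iso_jonsson[OF iso] tower_jt tower_jonsson
      by (simp add: jonsson_jt_algebra_def J_def)
    have "bij_betw (inv_into (universe (J S)) (g S)) (universe (B S)) (universe (J S))"
      using iso by (auto simp: algebra_iso_def intro: bij_betw_inv_into)
    then have "|universe (B S)| =o |universe (J S)|" by (rule card_of_ordIsoI)
    then show "|universe (B S)| =o aleph_one"
      using card_tower unfolding J_def by (rule ordIso_transitive)
    have base: "Base x \<in> universe (J S)" if "x \<in> universe A" for x
      using that by (simp add: J_def tower_def)
    show "\<exists>C. subalgebra jt_arity C (B S) \<and> isomorphic jt_arity A C"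
    proof (rule embedding_image[of _ _ "g S \<circ> Base"])
      show "is_ualg jt_arity A" using assms(1) by (simp add: jt_algebra_def)
      show "inj_on (g S \<circ> Base) (universe A)"
        using g[of S] base by (auto simp: inj_on_def)
      show "(g S \<circ> Base) ` universe A \<subseteq> universe (B S)"
        using base by (auto simp: B_def transport_def)
      fix f xs assume xs: "xs \<in> args jt_arity A f"
      then have "map Base xs \<in> args jt_arity (J S) f"
        using base by (auto simp: args_def)
      then have "g S (interp (J S) f (map Base xs)) = interp (B S) f (map (g S) (map Base xs))"
        using iso[of S] unfolding algebra_iso_def by blast
      moreover have "interp (J S) f (map Base xs) = Base (interp A f xs)"
        using xs by (cases f) (auto simp: J_def tower_def args_def length_Suc_conv numeral_2_eq_2)
      ultimately show "(g S \<circ> Base) (interp A f xs) = interp (B S) f (map (g S \<circ> Base) xs)"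
        by simp
    qed
  qed
  have "inj B"
    by (rule injI) (metis B_inj isomorphic_iff_algebra_iso algebra_iso_refl)
  then have "|range B| =o |UNIV :: omega_one set set|"
    by (rule ordIso_symmetric[OF card_of_ordIsoI[OF inj_on_imp_bij_betw]])
  then have "|range B| =o ctwo ^c aleph_one"
    using card_Pow_omega_one by (rule ordIso_transitive)
  then show ?thesis
    using B_props B_inj by (intro exI[of _ "range B"]) auto
qed

end
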